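(* Let $A$ and $B$ be finite sets of real numbers. Then the number of triples $(a,b,c)$ with $a\in A$, $b\in B$, $c\in A\cup B$, and $a+b=2c$ is at most $0.15(|A|+|B|)^2+0.5(|A|+|B|)$. *)

theory Defs
  imports Complex_Main
begin

end

theory Submission
  imports Defs "HOL-Analysis.Kronecker_Approximation_Theorem"
begin

text \<open>Induction on \<open>N = |A| + |B|\<close>. Simultaneous Diophantine approximation replaces the reals in
  \<open>A \<union> B\<close> by integers, and after halving we may assume that both parities occur. In a triple, \<open>a\<close>
  and \<open>b\<close> have the same parity, and \<open>c\<close> shares it iff \<open>a\<close> and \<open>b\<close> are congruent modulo 4. Let \<open>w\<close> be
  the size of the smaller parity class. A midpoint in that class of a pair from the larger class
  therefore comes from a pair of elements incongruent modulo 4, and since there are at most \<open>w\<close>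
  such midpoints, a Pollard-type inequality shows that many of these pairs have no midpoint in
  \<open>A \<union> B\<close>. In the critical range this yields \<open>(1 + 2w - 5w\<^sup>2)/8 \<le> 0.15\<close> in units where \<open>N = 1\<close>, with
  equality at \<open>w = 1/5\<close>. If one of the two classes modulo 4 is small, the induction hypothesis for
  the larger parity class suffices.\<close>

section \<open>Ranks in finite ordered sets\<close>

lemma inj_on_card_below:
  fixes S :: "'a::linorder set"
  assumes "finite S"
  shows "inj_on (\<lambda>x. card {y\<in>S. y < x}) S"
proof (rule linorder_inj_onI)
  fix x y assume "x < y" "x \<in> S" "y \<in> S"
  then have "{z\<in>S. z < x} \<subset> {z\<in>S. z < y}" by auto
  then have "card {z\<in>S. z < x} < card {z\<in>S. z < y}"
    using assms by (intro psubset_card_mono) auto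
  then show "card {z\<in>S. z < x} \<noteq> card {z\<in>S. z < y}" by simp
qed auto

lemma card_few_below:
  fixes S :: "'a::linorder set"
  assumes "finite S"
  shows "card {x\<in>S. card {y\<in>S. y < x} < t} \<le> t"
proof -
  have "card {x\<in>S. card {y\<in>S. y < x} < t} \<le> card {..<t}"
    by (rule card_inj_on_le[where f = "\<lambda>x. card {y\<in>S. y < x}"])
       (auto intro: inj_on_subset[OF inj_on_card_below[OF assms]])
  then show ?thesis by simp
qed

lemma card_many_below:
  fixes S :: "'a::linorder set"
  assumes "finite S"
  shows "card {x\<in>S. t \<le> card {y\<in>S. y < x}} \<le> card S - t"
proof -
  have "card {y\<in>S. y < x} < card S" if "x \<in> S" for x
    using that assms by (intro psubset_card_mono) auto
  then have "card {x\<in>S. t \<le> card {y\<in>S. y < x}} \<le> card {t..<card S}"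
    by (intro card_inj_on_le[where f = "\<lambda>x. card {y\<in>S. y < x}"])
       (auto intro: inj_on_subset[OF inj_on_card_below[OF assms]])
  then show ?thesis by simp
qed

lemma card_many_above:
  fixes S :: "real set"
  assumes "finite S"
  shows "card {x\<in>S. t \<le> card {y\<in>S. x < y}} \<le> card S - t"
proof -
  have below: "card {y \<in> uminus ` S. y < - x} = card {y\<in>S. x < y}" for x
  proof -
    have "{y \<in> uminus ` S. y < - x} = uminus ` {y\<in>S. x < y}" by auto
    then show ?thesis by (simp add: card_image)
  qed
  have "{x \<in> uminus ` S. t \<le> card {y \<in> uminus ` S. y < x}}
          = uminus ` {x\<in>S. t \<le> card {y\<in>S. x < y}}"
    by (auto simp: below)
  then show ?thesis
    using card_many_below[of "uminus ` S" t] assms by (simp add: card_image)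
qed

section \<open>Pollard-type bounds for pairs with prescribed midpoints\<close>

text \<open>A pair determines its midpoint, so counting triples amounts to counting pairs. A
  separate \<open>Z\<close> covers midpoints in one parity class as well as, with
  \<open>Z = UNIV\<close>, no restriction at all.\<close>

definition midpairs :: "real set \<Rightarrow> real set \<Rightarrow> real set \<Rightarrow> (real \<times> real) set" where
  "midpairs X Y Z = {(x, y). x \<in> X \<and> y \<in> Y \<and> (x + y) / 2 \<in> Z}"

lemma finite_midpairs [simp]: "finite X \<Longrightarrow> finite Y \<Longrightarrow> finite (midpairs X Y Z)"
  by (rule finite_subset[of _ "X \<times> Y"]) (auto simp: midpairs_def)

lemma card_midpairs_le_prod:
  "finite X \<Longrightarrow> finite Y \<Longrightarrow> card (midpairs X Y Z) \<le> card X * card Y"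
  unfolding card_cartesian_product[symmetric]
  by (rule card_mono) (auto simp: midpairs_def)

text \<open>Order the pairs with a given midpoint by their first component. A pair preceded by at least
  \<open>t\<close> others has \<open>t\<close> elements of \<open>X\<close> below its first component and \<open>t\<close> elements of \<open>Y\<close> above its
  second one, so there are at most \<open>(card X - t) * (card Y - t)\<close> such pairs over all midpoints.\<close>

lemma card_midpairs_le:
  assumes "finite X" "finite Y" "finite Z"
  shows "card (midpairs X Y Z) \<le> card Z * t + (card X - t) * (card Y - t)"
proof -
  define X' where "X' = {x\<in>X. t \<le> card {y\<in>X. y < x}}"
  define Y' where "Y' = {x\<in>Y. t \<le> card {y\<in>Y. x < y}}"
  have fib: "card (midpairs X Y {z} - X' \<times> Y') \<le> t" for z
  proof -
    define P where "P = {x\<in>X. 2 * z - x \<in> Y}"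
    have fin: "finite P" using assms by (simp add: P_def)
    have "midpairs X Y {z} - X' \<times> Y'
            \<subseteq> (\<lambda>x. (x, 2 * z - x)) ` {x\<in>P. card {y\<in>P. y < x} < t}"
    proof
      fix p assume p: "p \<in> midpairs X Y {z} - X' \<times> Y'"
      then obtain x y where xy: "p = (x, y)" "x \<in> X" "y \<in> Y" "(x + y) / 2 = z"
        by (auto simp: midpairs_def)
      then have "y = 2 * z - x" by simp
      then have x: "p = (x, 2 * z - x)" "x \<in> P" using xy by (auto simp: P_def)
      have "\<not> t \<le> card {y\<in>P. y < x}"
      proof
        assume le: "t \<le> card {y\<in>P. y < x}"
        have "card {y\<in>P. y < x} \<le> card {y\<in>X. y < x}"
          using assms by (intro card_mono) (auto simp: P_def)
        \<comment> \<open>Reflection in \<open>z\<close> sends the elements of \<open>P\<close>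
          below \<open>x\<close> into \<open>Y\<close>, above \<open>2 * z - x\<close>.\<close>
        moreover have "card {y\<in>P. y < x} \<le> card {y\<in>Y. 2 * z - x < y}"
          using assms
          by (intro card_inj_on_le[where f = "\<lambda>y. 2 * z - y"]) (auto simp: P_def inj_on_def)
        ultimately have "p \<in> X' \<times> Y'"
          using le x by (auto simp: X'_def Y'_def P_def)
        with p show False by blast
      qed
      then show "p \<in> (\<lambda>x. (x, 2 * z - x)) ` {x\<in>P. card {y\<in>P. y < x} < t}"
        using x by auto
    qed
    then have "card (midpairs X Y {z} - X' \<times> Y') \<le> card {x\<in>P. card {y\<in>P. y < x} < t}"
      using fin by (intro surj_card_le) auto
    also have "\<dots> \<le> t" by (rule card_few_below[OF fin])
    finally show ?thesis .
  qed
  have "midpairs X Y Z \<subseteq> (\<Union>z\<in>Z. midpairs X Y {z} - X' \<times> Y') \<union> X' \<times> Y'"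
    by (auto simp: midpairs_def)
  then have "card (midpairs X Y Z)
      \<le> card ((\<Union>z\<in>Z. midpairs X Y {z} - X' \<times> Y') \<union> X' \<times> Y')"
    using assms by (intro card_mono) (auto simp: X'_def Y'_def)
  also have "\<dots> \<le> card (\<Union>z\<in>Z. midpairs X Y {z} - X' \<times> Y') + card (X' \<times> Y')"
    by (rule card_Un_le)
  also have "card (\<Union>z\<in>Z. midpairs X Y {z} - X' \<times> Y')
      \<le> (\<Sum>z\<in>Z. card (midpairs X Y {z} - X' \<times> Y'))"
    using assms by (intro card_UN_le)
  also have "\<dots> \<le> (\<Sum>z\<in>Z. t)" by (intro sum_mono fib)
  also have "\<dots> = card Z * t" by simp
  also have "card (X' \<times> Y') \<le> (card X - t) * (card Y - t)"
    unfolding card_cartesian_product X'_def Y'_def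
    using assms by (intro mult_mono card_many_below card_many_above) auto
  finally show ?thesis by simp
qed

text \<open>The choice \<open>t = (x + y - w) / 2\<close> is optimal, the \<open>1/4\<close> pays for rounding it, and outside the
  range \<open>\<bar>x - y\<bar> \<le> w \<le> x + y\<close> the best \<open>t\<close> is an end point.\<close>

lemma card_midpairs_bounds:
  fixes w :: nat and k x y :: real
  assumes "finite X" "finite Y" "finite Z" "card Z \<le> w"
  defines "k \<equiv> real (card (midpairs X Y Z))" and "x \<equiv> real (card X)" and "y \<equiv> real (card Y)"
  shows "k \<le> x * y" "k \<le> w * x" "k \<le> w * y"
    and "\<bar>x - y\<bar> \<le> w \<Longrightarrow> w \<le> x + y \<Longrightarrow> k \<le> x * y - (x + y - w)\<^sup>2 / 4 + 1 / 4"
proof -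
  have bd: "card (midpairs X Y Z) \<le> w * t + (card X - t) * (card Y - t)" for t
    using card_midpairs_le[OF assms(1-3), of t] mult_le_mono1[OF assms(4), of t] by linarith
  show "k \<le> x * y"
    using card_midpairs_le_prod[OF assms(1,2), of Z]
    by (simp add: k_def x_def y_def flip: of_nat_mult)
  \<comment> \<open>For these \<open>t\<close> one truncated factor is 0, which leaves
    \<open>w * t\<close>.\<close>
  show "k \<le> w * x" "k \<le> w * y"
    using bd[of "card X"] bd[of "card Y"] by (simp_all add: k_def x_def y_def flip: of_nat_mult)
  show "k \<le> x * y - (x + y - w)\<^sup>2 / 4 + 1 / 4" if h: "\<bar>x - y\<bar> \<le> w" "w \<le> x + y"
  proof -
    define t where "t = (card X + card Y - w) div 2"
    define d where "d = (card X + card Y - w) mod 2"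
    have "card X + card Y - w = 2 * t + d" by (simp add: t_def d_def)
    then have sum: "x + y - w = 2 * real t + real d"
      using h unfolding x_def y_def by linarith
    \<comment> \<open>\<open>\<bar>x - y\<bar> \<le> w\<close> puts \<open>x + y - w\<close> below
      twice the smaller of \<open>x\<close> and \<open>y\<close>, so the natural subtractions of
      \<open>t\<close> are not truncated.\<close>
    have t: "t \<le> card X" "t \<le> card Y"
      using h sum unfolding x_def y_def by linarith+
    have "d = 0 \<or> d = 1" unfolding d_def by auto
    then have d: "(real d)\<^sup>2 \<le> 1" by auto
    have "real (card (midpairs X Y Z)) \<le> real (w * t + (card X - t) * (card Y - t))"
      using bd[of t] by (simp only: of_nat_le_iff)
    then have "k \<le> real w * real t + (x - real t) * (y - real t)"
      using t by (simp add: k_def x_def y_def of_nat_diff)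
    also have "\<dots> = x * y - (x + y - w)\<^sup>2 / 4 + (real d)\<^sup>2 / 4"
    proof -
      have w: "real w = x + y - 2 * real t - real d" using sum by simp
      show ?thesis unfolding w by (simp add: power2_eq_square field_simps)
    qed
    finally show ?thesis using d by simp
  qed
qed

section \<open>Integer models of finite sets of reals\<close>

text \<open>Some multiplier \<open>q > 0\<close> brings all elements of \<open>S\<close> close to
  integers at once. Rounding keeps every midpoint equation but may merge elements, so one chosen
  pair is kept apart.\<close>

lemma finite_real_integer_model:
  fixes S :: "real set"
  assumes "finite S" "s \<in> S" "s' \<in> S" "s \<noteq> s'"
  obtains k :: "real \<Rightarrow> int"
  where "k s \<noteq> k s'"
    and "\<And>a b c. a \<in> S \<Longrightarrow> b \<in> S \<Longrightarrow> c \<in> S \<Longrightarrow> a + b = 2 * c \<Longrightarrow> k a + k b = 2 * k c"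
proof -
  obtain n :: nat and f where f: "S = f ` {i. i < n}"
    using finite_imp_nat_seg_image_inj_on[OF assms(1)] by blast
  \<comment> \<open>\<open>M > 4\<close> makes the rounding errors in \<open>a + b - 2 * c\<close>
    total less than 1; \<open>2 / M < \<bar>s - s'\<bar>\<close> separates \<open>s\<close> from
    \<open>s'\<close>.\<close>
  obtain M :: nat where M: "M > 4 + 2 / \<bar>s - s'\<bar>" using reals_Archimedean2 by blast
  have nonneg: "2 / \<bar>s - s'\<bar> \<ge> 0" by simp
  then have "real M > 0" using M by linarith
  then have M0: "M > 0" by simp
  obtain q p where q: "0 < q"
    and p: "\<And>i. i < n \<Longrightarrow> \<bar>of_int q * f i - of_int (p i)\<bar> < 1 / M"
    using Dirichlet_approx_simult[OF M0, of n f] by metis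
  define k where "k = (\<lambda>x. p (SOME i. i < n \<and> f i = x))"
  have k: "\<bar>of_int q * x - of_int (k x)\<bar> < 1 / M" if "x \<in> S" for x
  proof -
    have "\<exists>i. i < n \<and> f i = x" using that f by auto
    from someI_ex[OF this] show ?thesis using p unfolding k_def by metis
  qed
  have "real M > 4" using M nonneg by linarith
  then have M4: "1 / M < 1 / 4" by (simp add: field_simps)
  have "2 / \<bar>s - s'\<bar> < M" using M by simp
  then have far: "2 * (1 / M) < \<bar>s - s'\<bar>" using M0 assms(4) by (simp add: field_simps)
  show thesis
  proof
    show "k s \<noteq> k s'"
    proof
      assume "k s = k s'"
      then have "\<bar>of_int q * s - of_int q * s'\<bar> < 2 * (1 / M)"
        using k[OF assms(2)] k[OF assms(3)] by linarith
      moreover have "\<bar>of_int q * s - of_int q * s'\<bar> = of_int q * \<bar>s - s'\<bar>"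
        using q by (simp add: abs_mult flip: right_diff_distrib)
      moreover have "of_int q * \<bar>s - s'\<bar> \<ge> 1 * \<bar>s - s'\<bar>"
        using q by (intro mult_right_mono) auto
      ultimately show False using far by simp
    qed
    fix a b c assume S: "a \<in> S" "b \<in> S" "c \<in> S" and "a + b = 2 * c"
    then have "of_int q * (a + b) = of_int q * (2 * c)" by simp
    then have "of_int q * a + of_int q * b = 2 * (of_int q * c)" by (simp add: distrib_left)
    then have "\<bar>of_int (k a + k b - 2 * k c)\<bar> < (1::real)"
      using k[OF S(1)] k[OF S(2)] k[OF S(3)] M4 by simp
    then show "k a + k b = 2 * k c" by linarith
  qed
qed

text \<open>If only one parity occurs, subtracting \<open>k s\<close> and halving preserves the
  midpoint equations and shrinks the nonzero distance of \<open>k s\<close> and \<open>k s'\<close>,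
  so this descent ends.\<close>

lemma finite_real_parity_model:
  fixes S :: "real set"
  assumes "finite S" "s \<in> S" "s' \<in> S" "s \<noteq> s'"
  obtains k :: "real \<Rightarrow> int"
  where "\<exists>x\<in>S. even (k x)" "\<exists>x\<in>S. odd (k x)"
    and "\<And>a b c. a \<in> S \<Longrightarrow> b \<in> S \<Longrightarrow> c \<in> S \<Longrightarrow> a + b = 2 * c \<Longrightarrow> k a + k b = 2 * k c"
proof -
  define hom where "hom = (\<lambda>k :: real \<Rightarrow> int.
    \<forall>a\<in>S. \<forall>b\<in>S. \<forall>c\<in>S. a + b = 2 * c \<longrightarrow> k a + k b = 2 * k c)"
  have descent: "\<exists>k. hom k \<and> (\<exists>x\<in>S. even (k x)) \<and> (\<exists>x\<in>S. odd (k x))"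
    if "hom k" "k s \<noteq> k s'" for k
    using that
  proof (induction "nat \<bar>k s - k s'\<bar>" arbitrary: k rule: less_induct)
    case less
    show ?case
    proof (cases "\<forall>x\<in>S. even (k x - k s)")
      case True
      define k' where "k' = (\<lambda>x. (k x - k s) div 2)"
      have k': "k x = k s + 2 * k' x" if "x \<in> S" for x
        using True that by (auto simp: k'_def)
      have "hom k'"
        using less.prems(1) unfolding hom_def by (force simp: k')
      moreover have "k' s \<noteq> k' s'" "nat \<bar>k' s - k' s'\<bar> < nat \<bar>k s - k s'\<bar>"
        using less.prems(2) k'[OF assms(2)] k'[OF assms(3)] by linarith+
      ultimately show ?thesis using less.hyps by blast
    next
      case False
      then obtain x where "x \<in> S" "odd (k x - k s)" by blast
      then show ?thesis using less.prems(1) assms(2) by auto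
    qed
  qed
  obtain k0 :: "real \<Rightarrow> int" where "k0 s \<noteq> k0 s'"
    and "\<And>a b c. a \<in> S \<Longrightarrow> b \<in> S \<Longrightarrow> c \<in> S \<Longrightarrow> a + b = 2 * c \<Longrightarrow> k0 a + k0 b = 2 * k0 c"
    using finite_real_integer_model[OF assms] by blast
  then obtain k where "hom k" "\<exists>x\<in>S. even (k x)" "\<exists>x\<in>S. odd (k x)"
    using descent[of k0] unfolding hom_def by blast
  then show thesis using that unfolding hom_def by blast
qed

section \<open>Real inequalities between class sizes\<close>

text \<open>This merges all ranges of the bounds on \<open>k\<close> into one formula. When
  \<open>\<bar>x - y\<bar> > w\<close> and \<open>w \<le> x + y\<close>, the difference of squares
  is exactly what \<open>k \<le> w * y\<close> or \<open>k \<le> w * x\<close> provides.\<close>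

lemma missing_pairs_ge:
  fixes x y w k :: real
  assumes "0 \<le> x" "0 \<le> y" "0 \<le> w" "k \<le> x * y" "k \<le> w * x" "k \<le> w * y"
    and mid: "\<bar>x - y\<bar> \<le> w \<Longrightarrow> w \<le> x + y \<Longrightarrow> k \<le> x * y - (x + y - w)\<^sup>2 / 4 + 1 / 4"
  shows "((max 0 (x + y - w))\<^sup>2 - (max 0 (\<bar>x - y\<bar> - w))\<^sup>2) / 4 - 1 / 4 \<le> x * y - k"
proof (cases "w \<le> x + y")
  case s: True
  consider "\<bar>x - y\<bar> \<le> w" | "x - y > w" | "y - x > w" by linarith
  then show ?thesis
  proof cases
    case 1
    then show ?thesis using mid s by simp
  next
    case 2
    then have "max 0 (x + y - w) = x + y - w" "max 0 (\<bar>x - y\<bar> - w) = x - y - w"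
      using s assms(3) by simp_all
    note max = this
    have eq: "((x + y - w)\<^sup>2 - (x - y - w)\<^sup>2) / 4 = x * y - w * y"
      by (simp add: power2_eq_square field_simps)
    show ?thesis unfolding max eq using assms(6) by linarith
  next
    case 3
    then have "max 0 (x + y - w) = x + y - w" "max 0 (\<bar>x - y\<bar> - w) = y - x - w"
      using s assms(3) by simp_all
    note max = this
    have eq: "((x + y - w)\<^sup>2 - (y - x - w)\<^sup>2) / 4 = x * y - w * x"
      by (simp add: power2_eq_square field_simps)
    show ?thesis unfolding max eq using assms(5) by linarith
  qed
next
  case False
  then have "((max 0 (x + y - w))\<^sup>2 - (max 0 (\<bar>x - y\<bar> - w))\<^sup>2) / 4 \<le> 0" by (simp add: max_def)
  then show ?thesis using assms(4) by linarith
qed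

lemma mult_le_quarter_square:
  fixes a b :: real
  shows "a * b \<le> (a + b)\<^sup>2 / 4"
  using zero_le_power2[of "a - b"] by (simp add: power2_eq_square field_simps)

text \<open>The left-hand side is convex in \<open>v\<close>, so it suffices to look at the two end points.\<close>

lemma unbalanced_classes_bound:
  fixes u v w N :: real
  assumes "0 \<le> w" and N: "N = u + v + w" and v1: "3 * N / 10 - 2 * w / 5 < v" and v2: "v + 2 * w < u"
  shows "u\<^sup>2 / 4 + v\<^sup>2 / 4 + w * v + w\<^sup>2 / 4 \<le> 3 * N\<^sup>2 / 20"
proof -
  \<comment> \<open>\<open>\<alpha>\<close> and \<open>\<beta>\<close> are the distances of
    \<open>v\<close> to its two bounds; \<open>h1\<close> and \<open>h2\<close> are right minus left
    side at the lower and the upper bound.\<close>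
  define \<alpha> where "\<alpha> = v - (3 * N / 10 - 2 * w / 5)"
  define \<beta> where "\<beta> = (N - 3 * w) / 2 - v"
  have pos: "\<alpha> > 0" "\<beta> > 0" using v1 v2 N by (simp_all add: \<alpha>_def \<beta>_def)
  define h1 where "h1 = N\<^sup>2 / 200 - 3 * N * w / 100 + w\<^sup>2 / 50"
  define h2 where "h2 = (N - 5 * w)\<^sup>2 / 40"
  have "N / 5 - 11 * w / 10 > 0" using pos by (simp add: \<alpha>_def \<beta>_def)
  then have "2 * N - 11 * w > 0" by simp
  then have "(2 * N - 11 * w) * (2 * N - w) \<ge> 0" using \<open>0 \<le> w\<close> by (intro mult_nonneg_nonneg) auto
  then have "0 \<le> ((2 * N - 11 * w) * (2 * N - w) + 5 * w\<^sup>2) / 800" by simp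
  also have "\<dots> = h1"
    by (simp add: h1_def power2_eq_square field_simps)
  finally have "h1 \<ge> 0" .
  have "h2 \<ge> 0" by (simp add: h2_def)
  \<comment> \<open>Right minus left side has leading coefficient -1/2 in \<open>v\<close>, hence
    exceeds its chord by \<open>\<alpha> * \<beta> / 2\<close>.\<close>
  have "(\<alpha> + \<beta>) * (3 * N\<^sup>2 / 20 - (u\<^sup>2 / 4 + v\<^sup>2 / 4 + w * v + w\<^sup>2 / 4))
          = \<beta> * h1 + \<alpha> * h2 + \<alpha> * \<beta> * (\<alpha> + \<beta>) / 2"
  proof -
    have u: "u = N - v - w" using N by simp
    show ?thesis
      unfolding u \<alpha>_def \<beta>_def h1_def h2_def by (simp add: power2_eq_square field_simps)
  qed
  also have "\<dots> \<ge> 0" using pos \<open>h1 \<ge> 0\<close> \<open>h2 \<ge> 0\<close> by simp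
  finally show ?thesis using pos by (simp add: zero_le_mult_iff)
qed

text \<open>Here \<open>x, x'\<close> and \<open>y', y\<close> count the elements of \<open>A\<close> and \<open>B\<close> in the two classes modulo 4 of the
  larger parity class, \<open>p, q\<close> those in the smaller parity class, and \<open>k, k'\<close> the pairs with
  incongruent members modulo 4 whose midpoint lies in the smaller parity class.\<close>

lemma class_sizes_bound:
  fixes x y x' y' p q k k' w N T U :: real
  assumes nonneg: "0 \<le> x" "0 \<le> y" "0 \<le> x'" "0 \<le> y'" "0 \<le> p" "0 \<le> q"
    and w: "w = p + q" and N: "N = x + x' + y + y' + w" "1 \<le> N"
    and small: "w \<le> N - w" "x' + y \<le> x + y'"
    and T1: "T \<le> x * y' + x' * y + p * q + k + k'"
    and T2: "T \<le> U + p * q + k + k'"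
    and U: "U \<le> 0.15 * (N - w)\<^sup>2 + 0.5 * (N - w)"
    and k: "k \<le> x * y" "k \<le> w * x" "k \<le> w * y"
      "\<bar>x - y\<bar> \<le> w \<Longrightarrow> w \<le> x + y \<Longrightarrow> k \<le> x * y - (x + y - w)\<^sup>2 / 4 + 1 / 4"
    and k': "k' \<le> x' * y'" "k' \<le> w * x'" "k' \<le> w * y'"
      "\<bar>x' - y'\<bar> \<le> w \<Longrightarrow> w \<le> x' + y' \<Longrightarrow> k' \<le> x' * y' - (x' + y' - w)\<^sup>2 / 4 + 1 / 4"
  shows "T \<le> 0.15 * N\<^sup>2 + 0.5 * N"
proof -
  have w0: "0 \<le> w" using nonneg w by simp
  have pq: "p * q \<le> w\<^sup>2 / 4" using mult_le_quarter_square w by simp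
  define v where "v = x' + y"
  have kk: "k + k' \<le> w * v" using k(3) k'(2) by (simp add: v_def distrib_left)
  \<comment> \<open>The four products in \<open>sq\<close> add up to
    \<open>(x + x') * (y + y')\<close>, whose factors differ by \<open>e + e'\<close>.\<close>
  define e e' where "e = x - y" and "e' = x' - y'"
  have sq: "x * y' + x' * y + x * y + x' * y' = (N - w)\<^sup>2 / 4 - (e + e')\<^sup>2 / 4"
    unfolding e_def e'_def N(1) by (simp add: power2_eq_square field_simps)
  \<comment> \<open>In \<open>even\<close>, counting all pairs of equal parity suffices. The
    threshold in \<open>ind\<close> is where \<open>w * v + w\<^sup>2 / 4\<close> meets
    \<open>0.15 * (N\<^sup>2 - (N - w)\<^sup>2)\<close>. In \<open>bad\<close>, \<open>e\<close> and
    \<open>e'\<close> are large of opposite sign and could cancel in \<open>e + e'\<close>.\<close>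
  consider (even) "(N - w)\<^sup>2 + w\<^sup>2 \<le> 3 * N\<^sup>2 / 5" | (ind) "v \<le> 3 * N / 10 - 2 * w / 5"
    | (bad) "3 * N / 10 - 2 * w / 5 < v" "e > w" "e' < - w"
    | (main) "3 * N\<^sup>2 / 5 < (N - w)\<^sup>2 + w\<^sup>2" "\<not> (e > w \<and> e' < - w)"
    by linarith
  then show ?thesis
  proof cases
    case even
    have "T \<le> (N - w)\<^sup>2 / 4 + w\<^sup>2 / 4"
      using T1 k(1) k'(1) sq pq zero_le_power2[of "e + e'"] by linarith
    then show ?thesis using even N(2) by simp
  next
    case ind
    have "w * v \<le> w * (3 * N / 10 - 2 * w / 5)" using ind w0 by (rule mult_left_mono)
    then have "T \<le> 0.15 * (N - w)\<^sup>2 + 0.5 * (N - w) + w\<^sup>2 / 4 + w * (3 * N / 10 - 2 * w / 5)"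
      using T2 U kk pq by linarith
    also have "\<dots> = 0.15 * N\<^sup>2 + 0.5 * N - 0.5 * w"
      by (simp add: power2_eq_square field_simps)
    finally show ?thesis using w0 by simp
  next
    case bad
    have "(x + y')\<^sup>2 / 4 + v\<^sup>2 / 4 + w * v + w\<^sup>2 / 4 \<le> 3 * N\<^sup>2 / 20"
      using bad w0 by (intro unbalanced_classes_bound) (auto simp: N v_def e_def e'_def)
    moreover have "x * y' \<le> (x + y')\<^sup>2 / 4" "x' * y \<le> v\<^sup>2 / 4"
      unfolding v_def by (rule mult_le_quarter_square)+
    ultimately have "T \<le> 3 * N\<^sup>2 / 20" using T1 pq kk by linarith
    then show ?thesis using N(2) by simp
  next
    case main
    \<comment> \<open>For \<open>w\<close> between \<open>N / 3\<close> and \<open>N / 2\<close>,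
      convexity gives \<open>(N - w)\<^sup>2 + w\<^sup>2 \<le> 5 * N\<^sup>2 / 9\<close>, contrary
      to \<open>main\<close>.\<close>
    have "3 * w \<le> N"
    proof (rule ccontr)
      assume "\<not> 3 * w \<le> N"
      then have "0 \<le> (3 * w - N) * (N - 2 * w)" "N * N \<le> N * (3 * w)"
        using small(1) N(2) by (intro mult_nonneg_nonneg mult_left_mono; simp)+
      then have "9 * ((N - w)\<^sup>2 + w\<^sup>2) \<le> 5 * N\<^sup>2"
        by (simp add: power2_eq_square algebra_simps)
      moreover have "N\<^sup>2 > 0" using N(2) by simp
      ultimately show False using main(1) by argo
    qed
    \<comment> \<open>The \<open>R\<close> terms are the gain from missing midpoints; the
      \<open>D\<close> terms are absorbed by the loss \<open>(e + e')\<^sup>2 / 4\<close> in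
      \<open>sq\<close>.\<close>
    define R R' where "R = max 0 (x + y - w)" and "R' = max 0 (x' + y' - w)"
    define D D' where "D = max 0 (\<bar>e\<bar> - w)" and "D' = max 0 (\<bar>e'\<bar> - w)"
    have "(R\<^sup>2 - D\<^sup>2) / 4 - 1 / 4 \<le> x * y - k" "(R'\<^sup>2 - D'\<^sup>2) / 4 - 1 / 4 \<le> x' * y' - k'"
      unfolding R_def D_def R'_def D'_def e_def e'_def
      using nonneg w0 k k' by (intro missing_pairs_ge; simp)+
    moreover have "(N - 3 * w)\<^sup>2 / 2 \<le> R\<^sup>2 + R'\<^sup>2"
    proof -
      have "N - 3 * w \<le> R + R'" using N(1) by (simp add: R_def R'_def)
      then have "(N - 3 * w)\<^sup>2 \<le> (R + R')\<^sup>2" using \<open>3 * w \<le> N\<close> by (intro power_mono) auto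
      also have "\<dots> \<le> 2 * (R\<^sup>2 + R'\<^sup>2)"
        using zero_le_power2[of "R - R'"] by (simp add: power2_eq_square algebra_simps)
      finally show ?thesis by simp
    qed
    moreover have "D\<^sup>2 + D'\<^sup>2 \<le> (e + e')\<^sup>2"
    proof -
      \<comment> \<open>Both opposite-sign cases are now excluded, so if \<open>D\<close> and
        \<open>D'\<close> are both positive, \<open>e\<close> and \<open>e'\<close> have the same
        sign.\<close>
      have "\<not> (e < - w \<and> e' > w)" using small(2) w0 by (simp add: e_def e'_def)
      then have "D + D' \<le> \<bar>e + e'\<bar>"
        using main(2) w0 unfolding D_def D'_def by (auto simp: max_def abs_if split: if_splits)
      then have "(D + D')\<^sup>2 \<le> (e + e')\<^sup>2"
        by (metis D_def D'_def abs_le_square_iff abs_of_nonneg add_nonneg_nonneg max.cobounded1)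
      moreover have "D * D' \<ge> 0" by (simp add: D_def D'_def)
      ultimately show ?thesis by (simp add: power2_sum)
    qed
    \<comment> \<open>The two rounding losses of 1/4 give the 1/2, which \<open>0.5 * N\<close> pays
      for since \<open>N \<ge> 1\<close>.\<close>
    ultimately have "T \<le> (N - w)\<^sup>2 / 4 + w\<^sup>2 / 4 - (N - 3 * w)\<^sup>2 / 8 + 1 / 2"
      using T1 sq pq by argo
    also have "\<dots> = 3 * N\<^sup>2 / 20 + 1 / 2 - (N - 5 * w)\<^sup>2 / 40"
      by (simp add: power2_eq_square field_simps)
    finally have "T \<le> 3 * N\<^sup>2 / 20 + 1 / 2" using zero_le_power2[of "N - 5 * w"] by argo
    then show ?thesis using N(2) by simp
  qed
qed

section \<open>Decomposition modulo 4\<close>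

text \<open>Both coverings read \<open>k a + k b = 2 * k c\<close> modulo 4. The first leaves
  congruent pairs to trivial product bounds; the second keeps the even class whole with its own
  midpoints, the shape the induction hypothesis needs.\<close>

lemma midpair_classes:
  fixes k :: "real \<Rightarrow> int"
  assumes hom: "\<And>a b c. a \<in> A \<union> B \<Longrightarrow> b \<in> A \<union> B \<Longrightarrow> c \<in> A \<union> B \<Longrightarrow> a + b = 2 * c
      \<Longrightarrow> k a + k b = 2 * k c"
    and X: "\<And>X. X0 X = {x\<in>X. 4 dvd k x}" "\<And>X. X2 X = {x\<in>X. even (k x) \<and> \<not> 4 dvd k x}"
      "\<And>X. X1 X = {x\<in>X. odd (k x)}"
  shows "midpairs A B (A \<union> B) \<subseteq> midpairs (X0 A) (X0 B) UNIV \<union> midpairs (X2 A) (X2 B) UNIV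
      \<union> midpairs (X1 A) (X1 B) UNIV \<union> midpairs (X0 A) (X2 B) (X1 (A \<union> B))
      \<union> midpairs (X2 A) (X0 B) (X1 (A \<union> B))" (is "_ \<subseteq> ?F")
    and "midpairs A B (A \<union> B) \<subseteq> midpairs (X0 A \<union> X2 A) (X0 B \<union> X2 B) (X0 A \<union> X2 A \<union> (X0 B \<union> X2 B))
      \<union> midpairs (X1 A) (X1 B) UNIV \<union> midpairs (X0 A) (X2 B) (X1 (A \<union> B))
      \<union> midpairs (X2 A) (X0 B) (X1 (A \<union> B))" (is "_ \<subseteq> ?C")
proof -
  have *: "odd (k a) \<and> odd (k b) \<or> 4 dvd k a \<and> 4 dvd k b \<and> even (k c)
      \<or> even (k a) \<and> \<not> 4 dvd k a \<and> even (k b) \<and> \<not> 4 dvd k b \<and> even (k c)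
      \<or> 4 dvd k a \<and> even (k b) \<and> \<not> 4 dvd k b \<and> odd (k c)
      \<or> even (k a) \<and> \<not> 4 dvd k a \<and> 4 dvd k b \<and> odd (k c)"
    if "a \<in> A" "b \<in> B" "c \<in> A \<union> B" "c = (a + b) / 2" for a b c
  proof -
    have "a + b = 2 * c" using that(4) by simp
    then have "k a + k b = 2 * k c" using hom that(1-3) by blast
    then show ?thesis by presburger
  qed
  have even4: "even m" if "4 dvd m" for m :: int using that by presburger
  have ab: "\<exists>a b. p = (a, b) \<and> a \<in> A \<and> b \<in> B \<and> (a + b) / 2 \<in> A \<union> B"
    if "p \<in> midpairs A B (A \<union> B)" for p
    using that by (auto simp: midpairs_def)
  show "midpairs A B (A \<union> B) \<subseteq> ?F"
  proof
    fix p assume "p \<in> midpairs A B (A \<union> B)"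
    then obtain a b where p: "p = (a, b)" and ab: "a \<in> A" "b \<in> B" "(a + b) / 2 \<in> A \<union> B"
      using ab by blast
    from *[OF ab refl] show "p \<in> ?F"
      unfolding X midpairs_def p using ab by (elim disjE conjE) simp_all
  qed
  show "midpairs A B (A \<union> B) \<subseteq> ?C"
  proof
    fix p assume "p \<in> midpairs A B (A \<union> B)"
    then obtain a b where p: "p = (a, b)" and ab: "a \<in> A" "b \<in> B" "(a + b) / 2 \<in> A \<union> B"
      using ab by blast
    from *[OF ab refl] show "p \<in> ?C"
      unfolding X midpairs_def p using ab by (elim disjE conjE) (auto dest: even4)
  qed
qed

section \<open>Induction on the total size\<close>

lemma card_midpairs_self_le:
  fixes A B :: "real set"
  assumes "finite A" "finite B"
  shows "real (card (midpairs A B (A \<union> B)))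
           \<le> 0.15 * (real (card A) + real (card B))\<^sup>2 + 0.5 * (real (card A) + real (card B))"
  using assms
proof (induction "card A + card B" arbitrary: A B rule: less_induct)
  case less
  note fin = less.prems
  show ?case
  proof (cases "\<exists>s\<in>A \<union> B. \<exists>s'\<in>A \<union> B. s \<noteq> s'")
    case False
    have small: "card X = 0 \<or> card X = 1" if "X \<subseteq> A \<union> B" for X
    proof (cases "X = {}")
      case nonempty: False
      then obtain x where "x \<in> X" by blast
      then have "X = {x}" using False that by blast
      then show ?thesis by simp
    qed simp
    have "card (midpairs A B (A \<union> B)) \<le> card A * card B"
      using fin by (rule card_midpairs_le_prod)
    then have "real (card (midpairs A B (A \<union> B))) \<le> real (card A) * real (card B)"
      by (simp flip: of_nat_mult)
    moreover have "card A = 0 \<or> card A = 1" "card B = 0 \<or> card B = 1" by (rule small; blast)+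
    ultimately show ?thesis by auto
  next
    case True
    define hom where "hom = (\<lambda>k :: real \<Rightarrow> int. \<forall>a\<in>A \<union> B. \<forall>b\<in>A \<union> B. \<forall>c\<in>A \<union> B.
      a + b = 2 * c \<longrightarrow> k a + k b = 2 * k c)"
    have hom_shift: "hom (\<lambda>x. k x + m)" if "hom k" for k m
      using that by (fastforce simp: hom_def)
    define n where "n = (\<lambda>P. card {a\<in>A. P a} + card {b\<in>B. P b})"
    obtain k0 where k0: "hom k0" "\<exists>x\<in>A \<union> B. even (k0 x)" "\<exists>x\<in>A \<union> B. odd (k0 x)"
      using True finite_real_parity_model[of "A \<union> B"] fin unfolding hom_def by (metis finite_Un)
    \<comment> \<open>Translation by 1 swaps the parity classes and preserves midpoint equations. As
      in \<open>card A + card B\<close>, common elements count twice in \<open>n\<close>.\<close>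
    obtain k1 where k1: "hom k1" "\<exists>x\<in>A \<union> B. odd (k1 x)"
      "n (\<lambda>x. odd (k1 x)) \<le> n (\<lambda>x. even (k1 x))"
    proof (cases "n (\<lambda>x. odd (k0 x)) \<le> n (\<lambda>x. even (k0 x))")
      case True
      then show ?thesis using that k0 by blast
    next
      case False
      then show ?thesis using that[of "\<lambda>x. k0 x + 1"] k0 hom_shift by simp
    qed
    \<comment> \<open>Translation by 2 keeps parity and swaps the residues 0 and 2 modulo 4.\<close>
    obtain k where k: "hom k" "\<exists>x\<in>A \<union> B. odd (k x)"
      "n (\<lambda>x. odd (k x)) \<le> n (\<lambda>x. even (k x))"
      "n (\<lambda>x. even (k x) \<and> \<not> 4 dvd k x) \<le> n (\<lambda>x. 4 dvd k x)"
    proof (cases "n (\<lambda>x. even (k1 x) \<and> \<not> 4 dvd k1 x) \<le> n (\<lambda>x. 4 dvd k1 x)")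
      case True
      then show ?thesis using that k1 by blast
    next
      case False
      have "4 dvd m + 2 \<longleftrightarrow> even m \<and> \<not> 4 dvd m" "even m \<and> \<not> 4 dvd m + 2 \<longleftrightarrow> 4 dvd m" for m :: int
        by presburger+
      then show ?thesis using False that[of "\<lambda>x. k1 x + 2"] k1 hom_shift by simp
    qed
    define X0 X2 X1 where "X0 = (\<lambda>X. {x\<in>X. 4 dvd k x})"
      and "X2 = (\<lambda>X. {x\<in>X. even (k x) \<and> \<not> 4 dvd k x})"
      and "X1 = (\<lambda>X. {x\<in>X. odd (k x)})" for X :: "real set"
    have finX: "finite (X0 X)" "finite (X1 X)" "finite (X2 X)" if "finite X" for X
      using that by (simp_all add: X0_def X1_def X2_def)
    have even4: "even m" if "4 dvd m" for m :: int using that by presburger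
    have evens: "{x\<in>X. even (k x)} = X0 X \<union> X2 X" for X
      using even4 by (auto simp: X0_def X2_def)
    have card_even: "card (X0 X \<union> X2 X) = card (X0 X) + card (X2 X)" if "finite X" for X
      using finX[OF that] by (intro card_Un_disjoint) (auto simp: X0_def X2_def)
    have card_all: "card X = card (X0 X) + card (X2 X) + card (X1 X)" if "finite X" for X
    proof -
      have "X = (X0 X \<union> X2 X) \<union> X1 X" using evens[of X] by (auto simp: X1_def)
      moreover have "(X0 X \<union> X2 X) \<inter> X1 X = {}" using evens[of X] by (auto simp: X1_def)
      ultimately show ?thesis
        using card_Un_disjoint[of "X0 X \<union> X2 X" "X1 X"] finX[OF that] card_even[OF that] by simp
    qed
    let ?w = "card (X1 A) + card (X1 B)"
    have "X1 A \<noteq> {} \<or> X1 B \<noteq> {}" using k(2) by (auto simp: X1_def)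
    \<comment> \<open>An odd element exists, so the even class is strictly smaller and the induction
      hypothesis applies to it.\<close>
    then have w: "?w > 0" using finX fin by (auto simp: card_gt_0_iff)
    have sizes: "?w \<le> card (X0 A) + card (X2 A) + card (X0 B) + card (X2 B)"
      "card (X2 A) + card (X2 B) \<le> card (X0 A) + card (X0 B)"
      using k(3,4) fin by (simp_all add: n_def evens card_even) (simp_all add: X0_def X2_def X1_def)
    have odd_centres: "card (X1 (A \<union> B)) \<le> ?w"
    proof -
      have "X1 (A \<union> B) = X1 A \<union> X1 B" by (auto simp: X1_def)
      then show ?thesis by (simp add: card_Un_le)
    qed
    have finC: "finite (X1 (A \<union> B))" using finX fin by simp
    note homk = k(1)[unfolded hom_def, rule_format]
    note cls = midpair_classes[of A B k X0 X2 X1, OF homk X0_def[THEN fun_cong]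
        X2_def[THEN fun_cong] X1_def[THEN fun_cong]]
    let ?M = "\<lambda>X Y Z. card (midpairs X Y Z)"
    let ?k = "?M (X0 A) (X2 B) (X1 (A \<union> B))" and ?k' = "?M (X2 A) (X0 B) (X1 (A \<union> B))"
    let ?T0 = "?M (X0 A \<union> X2 A) (X0 B \<union> X2 B) (X0 A \<union> X2 A \<union> (X0 B \<union> X2 B))"
    have un5: "card (P \<union> Q \<union> R \<union> S \<union> U) \<le> card P + card Q + card R + card S + card U"
      for P Q R S U :: "(real \<times> real) set"
      by (meson add_le_mono1 card_Un_le order_trans)
    have un4: "card (P \<union> Q \<union> R \<union> S) \<le> card P + card Q + card R + card S"
      for P Q R S :: "(real \<times> real) set"
      by (meson add_le_mono1 card_Un_le order_trans)
    have prods: "?M (X0 A) (X0 B) UNIV \<le> card (X0 A) * card (X0 B)"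
      "?M (X2 A) (X2 B) UNIV \<le> card (X2 A) * card (X2 B)"
      "?M (X1 A) (X1 B) UNIV \<le> card (X1 A) * card (X1 B)"
      using finX fin by (simp_all add: card_midpairs_le_prod)
    have "?M A B (A \<union> B) \<le> ?M (X0 A) (X0 B) UNIV + ?M (X2 A) (X2 B) UNIV
        + ?M (X1 A) (X1 B) UNIV + ?k + ?k'"
      using finX fin by (intro order_trans[OF card_mono[OF _ cls(1)] un5]) auto
    then have T1: "?M A B (A \<union> B) \<le> card (X0 A) * card (X0 B) + card (X2 A) * card (X2 B)
        + card (X1 A) * card (X1 B) + ?k + ?k'"
      using prods by linarith
    have "?M A B (A \<union> B) \<le> ?T0 + ?M (X1 A) (X1 B) UNIV + ?k + ?k'"
      using finX fin by (intro order_trans[OF card_mono[OF _ cls(2)] un4]) auto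
    then have T2: "?M A B (A \<union> B) \<le> ?T0 + card (X1 A) * card (X1 B) + ?k + ?k'"
      using prods by linarith
    have "card (X0 A \<union> X2 A) + card (X0 B \<union> X2 B) < card A + card B"
      using w fin by (simp add: card_even card_all[of A] card_all[of B])
    then have T0: "real ?T0 \<le> 0.15 * (real (card (X0 A \<union> X2 A)) + real (card (X0 B \<union> X2 B)))\<^sup>2
        + 0.5 * (real (card (X0 A \<union> X2 A)) + real (card (X0 B \<union> X2 B)))"
      using finX fin by (intro less.hyps) auto
    note kb = card_midpairs_bounds[OF finX(1)[OF fin(1)] finX(3)[OF fin(2)] finC odd_centres]
    note kb' = card_midpairs_bounds[OF finX(3)[OF fin(1)] finX(1)[OF fin(2)] finC odd_centres]
    show ?thesis
    proof (rule class_sizes_bound[where x = "real (card (X0 A))" and y = "real (card (X2 B))" and x' = "real (card (X2 A))"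
          and y' = "real (card (X0 B))" and p = "real (card (X1 A))" and q = "real (card (X1 B))" and w = "real ?w"
          and k = "real ?k" and k' = "real ?k'" and U = "real ?T0"])
      show "real (card A) + real (card B) = real (card (X0 A)) + real (card (X2 A))
          + real (card (X2 B)) + real (card (X0 B)) + real ?w"
        using card_all[OF fin(1)] card_all[OF fin(2)] by simp
      show "1 \<le> real (card A) + real (card B)"
        using w card_all[OF fin(1)] card_all[OF fin(2)] by linarith
      show "real ?w \<le> real (card A) + real (card B) - real ?w"
        using sizes(1) card_all[OF fin(1)] card_all[OF fin(2)] by linarith
      show "real (card (X2 A)) + real (card (X2 B)) \<le> real (card (X0 A)) + real (card (X0 B))"
        using sizes(2) by linarith
      show "real (?M A B (A \<union> B)) \<le> real (card (X0 A)) * real (card (X0 B))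
          + real (card (X2 A)) * real (card (X2 B)) + real (card (X1 A)) * real (card (X1 B))
          + real ?k + real ?k'"
        using T1 by (simp flip: of_nat_mult of_nat_add)
      show "real (?M A B (A \<union> B)) \<le> real ?T0 + real (card (X1 A)) * real (card (X1 B))
          + real ?k + real ?k'"
        using T2 by (simp flip: of_nat_mult of_nat_add)
      have "real (card (X0 A \<union> X2 A)) + real (card (X0 B \<union> X2 B))
          = real (card A) + real (card B) - real ?w"
        using fin by (simp add: card_even card_all[of A] card_all[of B])
      then show "real ?T0 \<le> 0.15 * (real (card A) + real (card B) - real ?w)\<^sup>2
          + 0.5 * (real (card A) + real (card B) - real ?w)"
        using T0 by simp
    qed (use kb kb' in simp_all)
  qed
qed

theorem theorem1:
  fixes A B :: "real set"
  assumes "finite A" and "finite B"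
  shows "real (card {(a, b, c). a \<in> A \<and> b \<in> B \<and> c \<in> A \<union> B \<and> a + b = 2 * c})
           \<le> 0.15 * (real (card A) + real (card B))\<^sup>2 + 0.5 * (real (card A) + real (card B))"
proof -
  have "{(a, b, c). a \<in> A \<and> b \<in> B \<and> c \<in> A \<union> B \<and> a + b = 2 * c}
      = (\<lambda>(a, b). (a, b, (a + b) / 2)) ` midpairs A B (A \<union> B)"
    by (auto simp: midpairs_def image_iff)
  then have "card {(a, b, c). a \<in> A \<and> b \<in> B \<and> c \<in> A \<union> B \<and> a + b = 2 * c}
      = card (midpairs A B (A \<union> B))"
    by (simp add: card_image inj_on_def split_beta prod_eq_iff)
  then show ?thesis using card_midpairs_self_le[OF assms] by simp
qed

end
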